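(* Let $G$ be a graph. If $G$ becomes a connected bipartite graph after the removal of $k$ vertices, then for every $A\in\ddot{\mathcal{S}}(G)$ the multiplicity of the largest eigenvalue of $A$ is at most $k+1$.
   Context: For a simple finite graph $G$ on $n$ vertices, $\ddot{\mathcal{S}}(G)$ is the set of discrete Schrödinger operators of $G$: $n\times n$ real symmetric matrices (indexed by $V(G)$) whose off-diagonal $i,j$-entry is negative if $\{i,j\}$ is an edge and zero if it is not; diagonal entries are arbitrary real numbers. *)

theory Defs
  imports "HOL-Analysis.Analysis" "Graph_Theory.Digraph_Component"
begin

text \<open>A finite simple graph is a symmetric digraph in the sense of the locale \<^locale>\<open>graph\<close>:
  finite, without loops and parallel arcs, where an edge between \<open>u\<close> and \<open>v\<close> is given by the two
  opposite arcs.\<close>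

definition bipartite :: "('v, 'e) pre_digraph \<Rightarrow> bool" where
  "bipartite G \<longleftrightarrow> (\<exists>U W. verts G = U \<union> W \<and> U \<inter> W = {} \<and>
     (\<forall>u v. u \<rightarrow>\<^bsub>G\<^esub> v \<longrightarrow> (u \<in> U \<and> v \<in> W) \<or> (u \<in> W \<and> v \<in> U)))"

text \<open>Rows and columns are indexed by the type \<open>'v\<close>, so this is meant for graphs with
  \<open>verts G = UNIV\<close>.\<close>

definition discrete_Schroedinger :: "('v::finite, 'e) pre_digraph \<Rightarrow> (real ^ 'v ^ 'v) set" where
  "discrete_Schroedinger G = {A. transpose A = A \<and>
     (\<forall>i j. i \<noteq> j \<longrightarrow> (i \<rightarrow>\<^bsub>G\<^esub> j \<longrightarrow> A $ i $ j < 0) \<and> (\<not> i \<rightarrow>\<^bsub>G\<^esub> j \<longrightarrow> A $ i $ j = 0))}"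

definition eigenvalues :: "real ^ 'n ^ 'n \<Rightarrow> real set" where
  "eigenvalues A = {c. \<exists>x. x \<noteq> 0 \<and> A *v x = c *\<^sub>R x}"

text \<open>The set of real eigenvalues is finite, and it is nonempty for symmetric \<open>A\<close>, so that the
  maximum below is attained.\<close>

definition largest_eigenvalue :: "real ^ 'n ^ 'n \<Rightarrow> real" where
  "largest_eigenvalue A = Max (eigenvalues A)"

text \<open>The dimension of the eigenspace; for symmetric \<open>A\<close> geometric and algebraic multiplicities
  coincide.\<close>

definition eigenvalue_multiplicity :: "real ^ 'n ^ 'n \<Rightarrow> real \<Rightarrow> nat" where
  "eigenvalue_multiplicity A c = dim {x. A *v x = c *\<^sub>R x}"

end

theory Submission
  imports Defs
begin

text \<open>
  Let \<open>c\<close> be the largest eigenvalue of \<open>A\<close>, let \<open>T\<close> be the complement of \<open>S\<close>, and fix one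
  vertex \<open>u\<close> of \<open>T\<close>. An eigenvector for \<open>c\<close> that vanishes on \<open>S\<close> and at \<open>u\<close> is zero;
  hence an eigenvector is determined by its \<open>k + 1\<close> coordinates on \<open>S \<union> {u}\<close>, which bounds the
  dimension of the eigenspace.

  The reason is a Perron-Frobenius argument with a twist of sign. Since \<open>A\<close> is symmetric, the
  eigenvectors for \<open>c\<close> are exactly the maximizers of the Rayleigh quotient
  (\<open>rayleigh_le_largest_eigenvalue\<close>, \<open>rayleigh_maximizer_is_eigenvector\<close>). Let \<open>x\<close> be such an
  eigenvector vanishing on \<open>S\<close>, and let \<open>\<sigma>\<close> be \<open>1\<close> on one colour class of \<open>T\<close> and \<open>-1\<close> on the
  other. All edges inside \<open>T\<close> carry negative entries and join vertices of opposite sign, so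
  passing from \<open>x\<close> to the vector \<open>y\<close> with \<open>y\<^sub>i = \<sigma>\<^sub>i \<bar>x\<^sub>i\<bar>\<close> keeps the norm and does not decrease the
  quadratic form. Therefore \<open>y\<close> is again an eigenvector for \<open>c\<close>. If \<open>x\<^sub>i = 0\<close> for some \<open>i\<close> in
  \<open>T\<close>, then row \<open>i\<close> of the eigenvalue equation for \<open>y\<close> is a sum of terms of one sign that equals
  zero, so \<open>x\<close> vanishes at all neighbours of \<open>i\<close> in \<open>T\<close> (\<open>zero_propagates\<close>). As the graph on
  \<open>T\<close> is connected, one zero in \<open>T\<close> forces \<open>x = 0\<close>.
\<close>

section \<open>Rayleigh quotients of symmetric matrices\<close>

lemma inner_matrix_symmetric:
  fixes A :: "real ^ 'n ^ 'n"
  assumes "transpose A = A"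
  shows "x \<bullet> (A *v y) = (A *v x) \<bullet> y"
  by (metis assms dot_lmul_matrix transpose_matrix_vector)

text \<open>The form \<open>c (z \<bullet> z) - z \<bullet> A z\<close> is positive semidefinite, and a vector on which such a form
  vanishes is a minimum of the form, so the gradient \<open>2 (c y - A y)\<close> is zero there. The proof
  evaluates the form at \<open>y + t w\<close>, where \<open>w = A y - c y\<close> is the direction of descent.\<close>

lemma rayleigh_maximizer_is_eigenvector:
  fixes A :: "real ^ 'n ^ 'n"
  assumes sym: "transpose A = A"
    and bound: "\<And>z. z \<bullet> (A *v z) \<le> c * (z \<bullet> z)"
    and max: "y \<bullet> (A *v y) = c * (y \<bullet> y)"
  shows "A *v y = c *\<^sub>R y"
proof -
  define w where "w = A *v y - c *\<^sub>R y"
  define q where "q = c * (w \<bullet> w) - w \<bullet> (A *v w)"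
  have Ayw: "y \<bullet> (A *v w) = (A *v y) \<bullet> w"
    by (rule inner_matrix_symmetric[OF sym])
  have ww: "w \<bullet> w = (A *v y) \<bullet> w - c * (y \<bullet> w)"
    by (simp add: w_def inner_diff_left)
  have comm: "w \<bullet> (A *v y) = (A *v y) \<bullet> w" "w \<bullet> y = y \<bullet> w"
    by (simp_all add: inner_commute)
  have ineq: "2 * t * (w \<bullet> w) \<le> t\<^sup>2 * q" for t
  proof -
    have "(y + t *\<^sub>R w) \<bullet> (A *v (y + t *\<^sub>R w)) =
        y \<bullet> (A *v y) + 2 * t * ((A *v y) \<bullet> w) + t\<^sup>2 * (w \<bullet> (A *v w))"
      by (simp add: matrix_vector_right_distrib matrix_vector_mult_scaleR inner_add_left
          inner_add_right power2_eq_square Ayw comm(1) algebra_simps)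
    moreover have "(y + t *\<^sub>R w) \<bullet> (y + t *\<^sub>R w) = y \<bullet> y + 2 * t * (y \<bullet> w) + t\<^sup>2 * (w \<bullet> w)"
      by (simp add: inner_add_left inner_add_right power2_eq_square comm(2) algebra_simps)
    ultimately have "2 * t * ((A *v y) \<bullet> w) + t\<^sup>2 * (w \<bullet> (A *v w))
        \<le> c * (2 * t * (y \<bullet> w)) + c * (t\<^sup>2 * (w \<bullet> w))"
      using bound[of "y + t *\<^sub>R w"] max by (simp add: distrib_left)
    moreover have "2 * t * (w \<bullet> w) = 2 * t * ((A *v y) \<bullet> w) - c * (2 * t * (y \<bullet> w))"
      unfolding ww by (simp add: algebra_simps)
    moreover have "t\<^sup>2 * q = c * (t\<^sup>2 * (w \<bullet> w)) - t\<^sup>2 * (w \<bullet> (A *v w))"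
      by (simp add: q_def algebra_simps)
    ultimately show ?thesis by linarith
  qed
  have "w \<bullet> w \<le> 0"
  proof (rule ccontr)
    assume "\<not> w \<bullet> w \<le> 0"
    then have pos: "w \<bullet> w > 0" by linarith
    \<comment> \<open>The denominator \<open>\<bar>q\<bar> + 1\<close> makes \<open>t q < w \<bullet> w\<close>, so that the linear term dominates.\<close>
    define t where "t = (w \<bullet> w) / (\<bar>q\<bar> + 1)"
    have t: "t > 0" using pos by (simp add: t_def)
    have "t * q \<le> t * (\<bar>q\<bar> + 1)" using t by (intro mult_left_mono) auto
    also have "\<dots> = w \<bullet> w" by (simp add: t_def)
    finally have "t * q \<le> w \<bullet> w" .
    moreover have "2 * (w \<bullet> w) \<le> t * q"
      using ineq[of t] t by (simp add: power2_eq_square)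
    ultimately show False using pos by linarith
  qed
  then have "w = 0" by (metis inner_eq_zero_iff inner_ge_zero order_antisym)
  then show ?thesis by (simp add: w_def)
qed

text \<open>Eigenvectors for distinct eigenvalues are orthogonal, and an orthogonal family in a
  finite-dimensional space is finite.\<close>

lemma finite_eigenvalues:
  fixes A :: "real ^ 'n ^ 'n"
  assumes sym: "transpose A = A"
  shows "finite (eigenvalues A)"
proof -
  have "\<forall>c\<in>eigenvalues A. \<exists>x. x \<noteq> 0 \<and> A *v x = c *\<^sub>R x" by (simp add: eigenvalues_def)
  then obtain v where v: "\<And>c. c \<in> eigenvalues A \<Longrightarrow> v c \<noteq> 0 \<and> A *v v c = c *\<^sub>R v c"
    unfolding bchoice_iff by blast
  have inj: "inj_on v (eigenvalues A)"
    by (rule inj_onI) (metis v scaleR_cancel_right)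
  have "pairwise orthogonal (v ` eigenvalues A)"
  proof (clarsimp simp: pairwise_def)
    fix c d assume cd: "c \<in> eigenvalues A" "d \<in> eigenvalues A" "v c \<noteq> v d"
    have "c * (v c \<bullet> v d) = d * (v c \<bullet> v d)"
      using inner_matrix_symmetric[OF sym, of "v c" "v d"] v[OF cd(1)] v[OF cd(2)] by auto
    moreover have "c \<noteq> d" using cd by auto
    ultimately show "orthogonal (v c) (v d)"
      by (simp add: orthogonal_def)
  qed
  then show ?thesis
    using pairwise_orthogonal_imp_finite finite_imageD inj by blast
qed

text \<open>The quadratic form attains a maximum on the compact unit sphere; the maximum value is an
  eigenvalue, hence at most the largest one.\<close>

lemma rayleigh_le_largest_eigenvalue:
  fixes A :: "real ^ 'n ^ 'n"
  assumes sym: "transpose A = A"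
  shows "z \<bullet> (A *v z) \<le> largest_eigenvalue A * (z \<bullet> z)"
proof -
  let ?f = "\<lambda>x. x \<bullet> (A *v x)"
  have "continuous_on (sphere 0 1) ?f"
    by (intro continuous_intros linear_continuous_on matrix_vector_mul_bounded_linear)
  moreover have "sphere (0 :: real ^ 'n) 1 \<noteq> {}" by simp
  ultimately obtain y where y: "norm y = 1" and ymax: "\<And>x. norm x = 1 \<Longrightarrow> ?f x \<le> ?f y"
    using continuous_attains_sup[of "sphere (0 :: real ^ 'n) 1" ?f] by auto
  have bound: "?f x \<le> ?f y * (x \<bullet> x)" for x
  proof (cases "x = 0")
    case False
    let ?u = "(1 / norm x) *\<^sub>R x"
    have "?f ?u \<le> ?f y" using False by (intro ymax) simp
    moreover have "?f ?u = ?f x / (x \<bullet> x)"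
      unfolding matrix_vector_mult_scaleR by (simp add: dot_square_norm power2_eq_square)
    ultimately have "?f x / (x \<bullet> x) \<le> ?f y" by metis
    then show ?thesis using False by (simp add: divide_le_eq)
  qed simp
  have yy: "y \<bullet> y = 1" using y by (simp add: dot_square_norm)
  have "A *v y = ?f y *\<^sub>R y"
    by (rule rayleigh_maximizer_is_eigenvector[OF sym bound]) (simp add: yy)
  moreover have "y \<noteq> 0" using y by auto
  ultimately have "?f y \<in> eigenvalues A" unfolding eigenvalues_def by blast
  then have "?f y \<le> largest_eigenvalue A"
    unfolding largest_eigenvalue_def by (rule Max_ge[OF finite_eigenvalues[OF sym]])
  then have "?f y * (z \<bullet> z) \<le> largest_eigenvalue A * (z \<bullet> z)"
    by (rule mult_right_mono) simp
  with bound[of z] show ?thesis by linarith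
qed

section \<open>Subspaces determined by few coordinates\<close>

text \<open>The projection onto the coordinates in \<open>I\<close> is injective on \<open>E\<close>, and the image lies in the
  span of the corresponding unit vectors.\<close>

lemma dim_le_card_determining_coordinates:
  fixes E :: "(real ^ 'n) set"
  assumes E: "subspace E"
    and det: "\<And>x. x \<in> E \<Longrightarrow> (\<And>i. i \<in> I \<Longrightarrow> x $ i = 0) \<Longrightarrow> x = 0"
  shows "dim E \<le> card I"
proof -
  define p :: "real ^ 'n \<Rightarrow> real ^ 'n" where "p x = (\<Sum>i\<in>I. (x $ i) *\<^sub>R axis i 1)" for x
  have lin: "linear p"
    by (rule linearI) (simp_all add: p_def scaleR_add_left sum.distrib scaleR_sum_right)
  have comp: "p x $ j = (if j \<in> I then x $ j else 0)" for x j
    by (simp add: p_def axis_def if_distrib cong: if_cong)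
  have inj: "inj_on p (span E)"
    unfolding span_eq_iff[THEN iffD2, OF E]
  proof (rule inj_onI)
    fix x y assume xy: "x \<in> E" "y \<in> E" "p x = p y"
    have "x - y = 0"
    proof (rule det)
      show "x - y \<in> E" using E xy by (simp add: subspace_diff)
      show "(x - y) $ i = 0" if "i \<in> I" for i
        using arg_cong[OF xy(3), of "\<lambda>z. z $ i"] that by (simp add: comp)
    qed
    then show "x = y" by simp
  qed
  have "dim (p ` E) = dim E"
    using lin inj by (rule dim_image_eq)
  moreover have "dim (p ` E) \<le> card ((\<lambda>i. axis i (1::real)) ` I :: (real ^ 'n) set)"
    by (rule dim_le_card) (auto simp: p_def intro: span_sum span_scale span_base)
  moreover have "\<dots> \<le> card I" by (rule card_image_le) simp
  ultimately show ?thesis by linarith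
qed

section \<open>Eigenvectors supported on a bipartite part\<close>

text \<open>Here \<open>T\<close> is a set of indices on which \<open>A\<close> has the sign pattern of a bipartite graph with
  colour classes given by the sign \<open>\<sigma>\<close>. Every nonzero off-diagonal term of the quadratic form
  becomes \<open>\<bar>A\<^sub>i\<^sub>j x\<^sub>i x\<^sub>j\<bar>\<close>, while the diagonal terms and the norm do not change. So the
  Rayleigh quotient remains maximal.\<close>

lemma signed_abs_eigenvector:
  fixes A :: "real ^ 'n ^ 'n" and \<sigma> :: "'n \<Rightarrow> real"
  assumes sym: "transpose A = A"
    and sign: "\<And>i. \<bar>\<sigma> i\<bar> = 1"
    and bip: "\<And>i j. i \<in> T \<Longrightarrow> j \<in> T \<Longrightarrow> i \<noteq> j \<Longrightarrow> A $ i $ j \<noteq> 0 \<Longrightarrow>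
      A $ i $ j < 0 \<and> \<sigma> i * \<sigma> j = -1"
    and x: "A *v x = largest_eigenvalue A *\<^sub>R x"
    and supp: "\<And>i. i \<notin> T \<Longrightarrow> x $ i = 0"
  shows "A *v (\<chi> i. \<sigma> i * \<bar>x $ i\<bar>) = largest_eigenvalue A *\<^sub>R (\<chi> i. \<sigma> i * \<bar>x $ i\<bar>)"
proof -
  define y where "y = (\<chi> i. \<sigma> i * \<bar>x $ i\<bar>)"
  have y_nth: "y $ i = \<sigma> i * \<bar>x $ i\<bar>" for i by (simp add: y_def)
  have sq: "\<sigma> i * \<sigma> i = 1" for i
    using sign[of i] by (metis abs_mult_self_eq mult_1)
  have yy_nth: "y $ i * y $ j = (\<sigma> i * \<sigma> j) * \<bar>x $ i * x $ j\<bar>" for i j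
    by (simp add: y_nth abs_mult)
  have form: "z \<bullet> (A *v z) = (\<Sum>i\<in>UNIV. \<Sum>j\<in>UNIV. A $ i $ j * (z $ i * z $ j))" for z
    by (simp add: inner_vec_def matrix_vector_mult_def sum_distrib_left mult_ac)
  have norm: "y \<bullet> y = x \<bullet> x"
    by (simp add: inner_vec_def yy_nth sq)
  have entry: "A $ i $ j * (x $ i * x $ j) \<le> A $ i $ j * (y $ i * y $ j)" for i j
  proof (cases "i = j \<or> A $ i $ j = 0 \<or> i \<notin> T \<or> j \<notin> T")
    case True
    then show ?thesis using supp[of i] supp[of j] by (auto simp: yy_nth sq)
  next
    case False
    then have neg: "A $ i $ j < 0" "\<sigma> i * \<sigma> j = -1" using bip[of i j] by auto
    have "y $ i * y $ j \<le> x $ i * x $ j" by (simp add: yy_nth neg)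
    then show ?thesis using neg(1) by (intro mult_left_mono_neg) auto
  qed
  have "largest_eigenvalue A * (y \<bullet> y) = x \<bullet> (A *v x)" by (simp add: x norm)
  also have "\<dots> \<le> y \<bullet> (A *v y)" unfolding form by (intro sum_mono entry)
  finally have "y \<bullet> (A *v y) = largest_eigenvalue A * (y \<bullet> y)"
    using rayleigh_le_largest_eigenvalue[OF sym, of y] by linarith
  from rayleigh_maximizer_is_eigenvector[OF sym rayleigh_le_largest_eigenvalue[OF sym] this]
  show ?thesis by (simp add: y_def)
qed

text \<open>Row \<open>i\<close> of the eigenvalue equation for the signed vector, multiplied by \<open>\<sigma>\<^sub>i\<close>, is a
  vanishing sum of the nonnegative numbers \<open>\<bar>A\<^sub>i\<^sub>m x\<^sub>m\<bar>\<close>.\<close>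

lemma zero_propagates:
  fixes A :: "real ^ 'n ^ 'n" and \<sigma> :: "'n \<Rightarrow> real"
  assumes sym: "transpose A = A"
    and sign: "\<And>i. \<bar>\<sigma> i\<bar> = 1"
    and bip: "\<And>i j. i \<in> T \<Longrightarrow> j \<in> T \<Longrightarrow> i \<noteq> j \<Longrightarrow> A $ i $ j \<noteq> 0 \<Longrightarrow>
      A $ i $ j < 0 \<and> \<sigma> i * \<sigma> j = -1"
    and x: "A *v x = largest_eigenvalue A *\<^sub>R x"
    and supp: "\<And>i. i \<notin> T \<Longrightarrow> x $ i = 0"
    and i: "i \<in> T" "x $ i = 0"
    and nz: "A $ i $ j \<noteq> 0"
  shows "x $ j = 0"
proof -
  have "A *v (\<chi> m. \<sigma> m * \<bar>x $ m\<bar>) = largest_eigenvalue A *\<^sub>R (\<chi> m. \<sigma> m * \<bar>x $ m\<bar>)"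
    using sym sign bip x supp by (rule signed_abs_eigenvector)
  then have "(\<Sum>m\<in>UNIV. A $ i $ m * (\<sigma> m * \<bar>x $ m\<bar>)) = 0"
    using i(2) by (simp add: matrix_vector_mult_def vec_eq_iff)
  then have "(\<Sum>m\<in>UNIV. \<sigma> i * (A $ i $ m * (\<sigma> m * \<bar>x $ m\<bar>))) = 0"
    by (simp flip: sum_distrib_left)
  moreover have eq: "\<sigma> i * (A $ i $ m * (\<sigma> m * \<bar>x $ m\<bar>)) = \<bar>A $ i $ m * x $ m\<bar>" for m
  proof (cases "m = i \<or> m \<notin> T \<or> A $ i $ m = 0")
    case True
    then show ?thesis using i supp by auto
  next
    case False
    then have neg: "A $ i $ m < 0" "\<sigma> i * \<sigma> m = -1" using bip[of i m] i(1) by auto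
    have "\<sigma> i * (A $ i $ m * (\<sigma> m * \<bar>x $ m\<bar>)) = (\<sigma> i * \<sigma> m) * (A $ i $ m * \<bar>x $ m\<bar>)"
      by (simp add: mult_ac)
    then show ?thesis using neg by (simp add: abs_mult)
  qed
  ultimately have "(\<Sum>m\<in>UNIV. \<bar>A $ i $ m * x $ m\<bar>) = 0" by simp
  then have "\<bar>A $ i $ j * x $ j\<bar> = 0" by (subst (asm) sum_nonneg_eq_0_iff) auto
  then show ?thesis using nz by simp
qed

section \<open>The multiplicity bound\<close>

lemma adj_induce_subgraph_iff:
  "u \<rightarrow>\<^bsub>G \<restriction> T\<^esub> v \<longleftrightarrow> u \<in> T \<and> v \<in> T \<and> u \<rightarrow>\<^bsub>G\<^esub> v"
  by (auto simp: arcs_ends_conv)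

lemma connected_closed_set:
  assumes "sym_digraph H"
    and "Digraph_Component.connected H"
    and "P u" "u \<in> verts H" "v \<in> verts H"
    and step: "\<And>a b. a \<rightarrow>\<^bsub>H\<^esub> b \<Longrightarrow> P a \<Longrightarrow> P b"
  shows "P v"
proof -
  interpret H: sym_digraph H by fact
  have "u \<rightarrow>\<^sup>*\<^bsub>H\<^esub> v"
    using assms by (auto simp: connected_def strongly_connected_def
        H.reachable_mk_symmetric_eq[OF H.sym_arcs])
  then show ?thesis
    by (induction rule: H.reachable_induct) (use \<open>P u\<close> step in auto)
qed

theorem corollary2p9:
  fixes G :: "('v::finite, 'e) pre_digraph"
    and S :: "'v set"
    and k :: nat
    and A :: "real ^ 'v ^ 'v"
  assumes "graph G"
    and "verts G = UNIV"
    and "S \<subseteq> verts G"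
    and "card S = k"
    and "Digraph_Component.connected (G \<restriction> (verts G - S))"
    and "bipartite (G \<restriction> (verts G - S))"
    and "A \<in> discrete_Schroedinger G"
  shows "eigenvalue_multiplicity A (largest_eigenvalue A) \<le> k + 1"
proof -
  interpret G: graph G by fact
  define T where "T = verts G - S"
  have T_iff: "i \<in> T \<longleftrightarrow> i \<notin> S" for i using assms(2) by (simp add: T_def)
  have conn: "Digraph_Component.connected (G \<restriction> T)" using assms(5) by (simp add: T_def)
  have sym_T: "sym_digraph (G \<restriction> T)"
    by (intro G.induced_graph_imp_graph G.induced_induce) (auto simp: T_def)
  have sym: "transpose A = A"
    and edge: "\<And>i j. i \<noteq> j \<Longrightarrow> i \<rightarrow>\<^bsub>G\<^esub> j \<Longrightarrow> A $ i $ j < 0"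
    and nonedge: "\<And>i j. i \<noteq> j \<Longrightarrow> \<not> i \<rightarrow>\<^bsub>G\<^esub> j \<Longrightarrow> A $ i $ j = 0"
    using assms(7) by (auto simp: discrete_Schroedinger_def)
  obtain U W where UW: "U \<inter> W = {}"
    "\<And>u v. u \<rightarrow>\<^bsub>G \<restriction> T\<^esub> v \<Longrightarrow> (u \<in> U \<and> v \<in> W) \<or> (u \<in> W \<and> v \<in> U)"
    using assms(6) unfolding bipartite_def T_def by blast
  define \<sigma> :: "'v \<Rightarrow> real" where "\<sigma> i = (if i \<in> U then 1 else -1)" for i
  have sign: "\<bar>\<sigma> i\<bar> = 1" for i by (simp add: \<sigma>_def)
  have bip: "A $ i $ j < 0 \<and> \<sigma> i * \<sigma> j = -1"
    if "i \<in> T" "j \<in> T" "i \<noteq> j" "A $ i $ j \<noteq> 0" for i j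
  proof -
    have "i \<rightarrow>\<^bsub>G\<^esub> j" using nonedge that by blast
    moreover from this have "(i \<in> U \<and> j \<in> W) \<or> (i \<in> W \<and> j \<in> U)"
      using that by (intro UW(2)) (simp add: adj_induce_subgraph_iff)
    ultimately show ?thesis using edge that UW(1) by (auto simp: \<sigma>_def)
  qed
  obtain u where u: "u \<in> T"
    using conn by (auto simp: connected_def strongly_connected_def)
  let ?E = "{x. A *v x = largest_eigenvalue A *\<^sub>R x}"
  have "dim ?E \<le> card (insert u S)"
  proof (rule dim_le_card_determining_coordinates)
    show "subspace ?E"
      by (auto simp: subspace_def matrix_vector_right_distrib matrix_vector_mult_scaleR
          scaleR_add_right)
  next
    fix x assume "x \<in> ?E" and zero: "\<And>i. i \<in> insert u S \<Longrightarrow> x $ i = 0"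
    then have x: "A *v x = largest_eigenvalue A *\<^sub>R x" by simp
    have supp: "x $ i = 0" if "i \<notin> T" for i using zero that T_iff by auto
    have "x $ i = 0" if "i \<in> T" for i
    proof (rule connected_closed_set[OF sym_T conn, where P = "\<lambda>i. x $ i = 0"])
      show "x $ u = 0" "u \<in> verts (G \<restriction> T)" "i \<in> verts (G \<restriction> T)"
        using zero u that by auto
    next
      fix a b assume ab: "a \<rightarrow>\<^bsub>G \<restriction> T\<^esub> b" and "x $ a = 0"
      have "a \<in> T" "a \<rightarrow>\<^bsub>G\<^esub> b" using ab by (simp_all add: adj_induce_subgraph_iff)
      moreover have "a \<noteq> b" using \<open>a \<rightarrow>\<^bsub>G\<^esub> b\<close> G.adj_not_same by blast
      ultimately have "A $ a $ b \<noteq> 0" using edge by fastforce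
      with sym sign bip x supp \<open>a \<in> T\<close> \<open>x $ a = 0\<close> show "x $ b = 0"
        by (rule zero_propagates)
    qed
    then show "x = 0" using supp by (auto simp: vec_eq_iff)
  qed
  also have "\<dots> = k + 1" using u T_iff assms(4) by simp
  finally show ?thesis by (simp add: eigenvalue_multiplicity_def)
qed

end
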